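(* Let $r$ be a positive integer and $d$ be a nonnegative integer such that $r\ge d$. For every integer $n\ge d$ and every positive integer $N$, we have $$\sum_{k=0}^{N-1}q^{rk}[k]^{n-d}=\frac{q^{(r-d)N}\,T_n(N)-T_n(0)}{n(n-1)\cdots(n-d+1)},$$ where $(T_k(X))_{k\ge 0}$ is the Carlitz-type $q$-polynomial sequence associated to the real sequence of general term $$b_k=(q-1)^{d-1}\,\frac{k(k-1)\cdots(k-d+1)}{[k+r-d]}\qquad(\forall k\ge 0).$$
   Context: Let $q$ be a positive real parameter, $q\neq 1$, and put $[X]:=\frac{q^X-1}{q-1}$, where $X$ is an indeterminate or a number. A $q$-polynomial is a polynomial in $q^X$ (equivalently in $[X]$) with real coefficients. The Carlitz-type $q$-polynomial sequence associated to a real sequence $(a_k)_{k\ge 0}$ is the sequence $(T_n(X))_{n\ge 0}$ defined by $$T_n(X)=(q-1)^{-n}\sum_{k=0}^{n}(-1)^{n-k}\binom{n}{k}a_k\,q^{kX}.$$ Products $m(m-1)\cdots(m-d+1)$ are empty, hence equal to $1$, when $d=0$, and $[k]^0=1$ (also for $k=0$). The paper's convention is that $\frac{k}{[k]}=1$ for $k=0$. *)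

theory Defs
  imports Complex_Main
begin

definition qnum :: "real \<Rightarrow> real \<Rightarrow> real" where
  "qnum q x = (q powr x - 1) / (q - 1)"

text \<open>The \<open>q\<close>-polynomial \<open>T\<^sub>n(X)\<close> is represented by the real function
  \<open>x \<mapsto> T\<^sub>n(x)\<close>; \<open>powr\<close> is the ordinary power here, since \<open>q\<close> is assumed positive.\<close>

definition carlitz_seq :: "real \<Rightarrow> (nat \<Rightarrow> real) \<Rightarrow> nat \<Rightarrow> real \<Rightarrow> real" where
  "carlitz_seq q a n x =
     (q - 1) powi (- int n) *
     (\<Sum>k\<le>n. (-1) ^ (n - k) * real (n choose k) * a k * q powr (real k * x))"

definition falling_prod :: "real \<Rightarrow> nat \<Rightarrow> real" where
  "falling_prod x d = (\<Prod>i<d. x - real i)"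

text \<open>The quotient \<open>k / [k]\<close>, with the convention that it equals \<open>1\<close> at \<open>k = 0\<close>.\<close>

definition qratio :: "real \<Rightarrow> nat \<Rightarrow> real" where
  "qratio q k = (if k = 0 then 1 else real k / qnum q (real k))"

text \<open>The quotient \<open>k (k - 1) \<cdots> (k - d + 1) / [k + r - d]\<close> has a vanishing denominator
  only for \<open>r = d\<close> and \<open>k = 0\<close>. If \<open>r = d\<close>, then \<open>d \<ge> 1\<close> (as \<open>r\<close> is positive), and the quotient
  is read as \<open>(k / [k]) (k - 1) \<cdots> (k - d + 1)\<close>, so that the convention for \<open>k / [k]\<close> applies.\<close>

definition carlitz_coeff :: "real \<Rightarrow> nat \<Rightarrow> nat \<Rightarrow> nat \<Rightarrow> real" where
  "carlitz_coeff q r d k =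
     (q - 1) powi (int d - 1) *
     (if r = d then qratio q k * (\<Prod>i\<in>{1..<d}. real k - real i)
      else falling_prod (real k) d / qnum q (real k + real r - real d))"

end

theory Submission
  imports Defs
begin

text \<open>Writing \<open>Q = q ^ (k + r - d)\<close>, the factor \<open>1 / [k + r - d]\<close> in the coefficient is
  \<open>(q - 1) / (Q - 1)\<close>, which turns \<open>Q ^ N - 1\<close> into the geometric sum of the \<open>Q ^ j\<close>. The falling
  product absorbs into \<open>n choose k\<close> and shifts it to \<open>(n - d) choose (k - d)\<close>. After exchanging
  the two sums, the inner one is the binomial expansion of \<open>(q ^ j - 1) ^ (n - d)\<close>.\<close>

text \<open>In this form it is visible that the falling product vanishes for \<open>k < d\<close>
  and is nonzero for \<open>k \<ge> d\<close>.\<close>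

lemma falling_prod_of_nat: "falling_prod (real k) d = fact d * real (k choose d)"
  by (simp add: falling_prod_def binomial_gbinomial gbinomial_prod_rev atLeast0LessThan)

text \<open>Trinomial revision, multiplied by \<open>fact d\<close>.\<close>

lemma falling_prod_times_binomial:
  assumes "d \<le> k" "k \<le> n"
  shows "real (n choose k) * falling_prod (real k) d
    = falling_prod (real n) d * real ((n - d) choose (k - d))"
proof -
  have "real (n choose k) * real (k choose d) = real (n choose d) * real ((n - d) choose (k - d))"
    using choose_mult[OF assms] by (metis of_nat_mult)
  then show ?thesis by (simp add: falling_prod_of_nat)
qed

lemma qnum_of_nat: "q > 0 \<Longrightarrow> qnum q (real m) = (q ^ m - 1) / (q - 1)"
  by (simp add: qnum_def powr_realpow)

text \<open>The last hypothesis excludes only \<open>k = 0\<close> with \<open>r = d\<close>, where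
  the denominator vanishes; elsewhere both branches of the definition give the same
  quotient.\<close>

lemma carlitz_coeff_eq:
  assumes "q > 0" "q \<noteq> 1" "r > 0" "d \<le> r" "k + (r - d) > 0"
  shows "carlitz_coeff q r d k = (q - 1) ^ d * falling_prod (real k) d / (q ^ (k + (r - d)) - 1)"
proof -
  have pow: "(q - 1) powi (int d - 1) = (q - 1) ^ d / (q - 1)"
    using assms by (simp add: power_int_diff)
  show ?thesis
  proof (cases "r = d")
    case True
    \<comment> \<open>Since \<open>d = r > 0\<close>, the factor \<open>k\<close> splits off; it is
      the numerator of \<open>qratio q k\<close>, and \<open>k > 0\<close> here.\<close>
    then have "{..<d} = insert 0 {1..<d}" using assms by auto
    then have "falling_prod (real k) d = real k * (\<Prod>i\<in>{1..<d}. real k - real i)"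
      by (simp add: falling_prod_def)
    then show ?thesis using True assms pow
      by (simp add: carlitz_coeff_def qratio_def qnum_of_nat)
  next
    case False
    have "real k + real r - real d = real (k + (r - d))" using assms by simp
    then have "qnum q (real k + real r - real d) = (q ^ (k + (r - d)) - 1) / (q - 1)"
      using assms qnum_of_nat by metis
    then show ?thesis using False assms pow by (simp add: carlitz_coeff_def)
  qed
qed

text \<open>The form without division also covers \<open>k = 0\<close> with \<open>r = d\<close>:
  the left side contains \<open>q ^ 0 - 1\<close>, and on the right the falling product is zero
  because \<open>d > 0\<close>.\<close>

lemma carlitz_coeff_geometric:
  assumes "q > 0" "q \<noteq> 1" "r > 0" "d \<le> r"
  shows "carlitz_coeff q r d k * (q ^ ((k + (r - d)) * N) - 1)
    = (q - 1) ^ d * falling_prod (real k) d * (\<Sum>j<N. q ^ ((k + (r - d)) * j))"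
proof (cases "k + (r - d) = 0")
  case True
  then have "falling_prod (real k) d = 0"
    using assms by (simp add: falling_prod_of_nat)
  then show ?thesis using True by simp
next
  case False
  define Q where "Q = q ^ (k + (r - d))"
  have "Q \<noteq> 1"
    using assms False power_eq_1_iff[of q "k + (r - d)"] unfolding Q_def by fastforce
  moreover have "Q ^ N - 1 = (Q - 1) * (\<Sum>j<N. Q ^ j)"
    by (rule power_diff_1_eq)
  moreover have "carlitz_coeff q r d k = (q - 1) ^ d * falling_prod (real k) d / (Q - 1)"
    unfolding Q_def using assms False by (intro carlitz_coeff_eq) auto
  ultimately show ?thesis by (simp add: power_mult flip: Q_def)
qed

text \<open>Both sides are \<open>y ^ d\<close> times the \<open>d\<close>-th derivative of
  \<open>(y - 1) ^ n\<close>. The proof is algebraic: terms with \<open>k < d\<close> vanish, and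
  \<open>k = m + d\<close> leaves a binomial expansion.\<close>

lemma sum_falling_prod_binomial:
  assumes "d \<le> n"
  shows "(\<Sum>k\<le>n. (-1) ^ (n - k) * real (n choose k) * falling_prod (real k) d * y ^ k)
    = falling_prod (real n) d * y ^ d * (y - 1) ^ (n - d)"
proof -
  have "(\<Sum>k\<le>n. (-1) ^ (n - k) * real (n choose k) * falling_prod (real k) d * y ^ k)
    = (\<Sum>k\<in>{d..n}. (-1) ^ (n - k) * real (n choose k) * falling_prod (real k) d * y ^ k)"
    by (intro sum.mono_neutral_right) (auto simp: falling_prod_of_nat)
  also have "\<dots> = (\<Sum>k\<in>{d..n}. (-1) ^ (n - k)
      * (falling_prod (real n) d * real ((n - d) choose (k - d))) * y ^ k)"
    using falling_prod_times_binomial by (intro sum.cong) (auto simp: mult.assoc)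
  also have "\<dots> = (\<Sum>m\<le>n - d. (-1) ^ (n - d - m)
      * (falling_prod (real n) d * real ((n - d) choose m)) * y ^ (m + d))"
    by (rule sum.reindex_bij_witness[of _ "\<lambda>m. m + d" "\<lambda>k. k - d"]) (use assms in auto)
  also have "\<dots> = falling_prod (real n) d * y ^ d
      * (\<Sum>m\<le>n - d. real ((n - d) choose m) * y ^ m * (-1) ^ (n - d - m))"
    by (simp add: sum_distrib_left power_add algebra_simps)
  also have "\<dots> = falling_prod (real n) d * y ^ d * (y - 1) ^ (n - d)"
    using binomial_ring[of y "-1" "n - d"] by simp
  finally show ?thesis .
qed

theorem theorem2p7:
  fixes q :: real and r d n N :: nat
  assumes "q > 0" and "q \<noteq> 1"
    and "r > 0" and "r \<ge> d" and "n \<ge> d" and "N > 0"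
  shows "(\<Sum>k = 0..N - 1. q ^ (r * k) * qnum q (real k) ^ (n - d)) =
    (q ^ ((r - d) * N) * carlitz_seq q (carlitz_coeff q r d) n (real N)
       - carlitz_seq q (carlitz_coeff q r d) n 0)
    / falling_prod (real n) d"
proof -
  define e where "e = r - d"
  let ?s = "\<lambda>k. (-1) ^ (n - k) * real (n choose k)"
  let ?b = "carlitz_coeff q r d"
  let ?F = "falling_prod (real n) d"
  have F: "?F \<noteq> 0" using assms by (simp add: falling_prod_of_nat)
  have pn: "(q - 1) powi (- int n) = 1 / (q - 1) ^ n"
    by (simp add: power_int_minus divide_inverse)
  have "q powr (real k * real N) = q ^ (k * N)" for k
    using assms powr_realpow[of q "k * N"] by simp
  \<comment> \<open>At \<open>0\<close> every power \<open>q ^ (k * X)\<close> is \<open>1\<close>,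
    so the two values combine termwise into \<open>q ^ ((k + e) * N) - 1\<close>.\<close>
  then have "q ^ (e * N) * carlitz_seq q ?b n (real N) - carlitz_seq q ?b n 0
    = 1 / (q - 1) ^ n * (\<Sum>k\<le>n. ?s k * (?b k * (q ^ ((k + e) * N) - 1)))"
    using assms by (simp add: carlitz_seq_def pn sum_distrib_left sum_distrib_right
        sum_subtractf power_add algebra_simps sum_divide_distrib diff_divide_distrib flip: e_def)
  also have "\<dots> = 1 / (q - 1) ^ n * (\<Sum>k\<le>n. \<Sum>j<N.
      (q - 1) ^ d * q ^ (e * j) * (?s k * falling_prod (real k) d * (q ^ j) ^ k))"
    unfolding carlitz_coeff_geometric[OF assms(1-4), folded e_def] sum_distrib_left
    by (simp add: power_add algebra_simps flip: power_mult)
  also have "\<dots> = 1 / (q - 1) ^ n * (\<Sum>j<N. (q - 1) ^ d * q ^ (e * j)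
      * (\<Sum>k\<le>n. ?s k * falling_prod (real k) d * (q ^ j) ^ k))"
    by (subst sum.swap) (simp add: sum_distrib_left)
  also have "\<dots> = (\<Sum>j<N. ?F * (q ^ (r * j) * ((q - 1) ^ d * (q ^ j - 1) ^ (n - d) / (q - 1) ^ n)))"
  proof -
    \<comment> \<open>The exponent \<open>r * j\<close> arises from \<open>e * j\<close> in the
      geometric sum and \<open>d * j\<close> from the index shift in the binomial sum.\<close>
    have "r = e + d" using assms by (simp add: e_def)
    then have pow: "q ^ (e * j) * (q ^ j) ^ d = q ^ (r * j)" for j
      by (simp add: algebra_simps flip: power_mult power_add)
    have "(q - 1) ^ d * q ^ (e * j) * (?F * (q ^ j) ^ d * (q ^ j - 1) ^ (n - d))
      = ?F * (q ^ (r * j) * ((q - 1) ^ d * (q ^ j - 1) ^ (n - d)))" for j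
      unfolding pow[symmetric] by (simp only: mult_ac)
    then show ?thesis
      by (simp only: sum_falling_prod_binomial[OF assms(5)]) (simp add: sum_divide_distrib)
  qed
  also have "\<dots> = ?F * (\<Sum>j<N. q ^ (r * j) * qnum q (real j) ^ (n - d))"
  proof -
    \<comment> \<open>What remains of the prefactor is \<open>n - d\<close> powers of
      \<open>q - 1\<close>, the denominators of \<open>qnum q (real j) ^ (n - d)\<close>.\<close>
    have "(q - 1) ^ n = (q - 1) ^ d * (q - 1) ^ (n - d)"
      using assms by (simp flip: power_add)
    then have "(q - 1) ^ d * (q ^ j - 1) ^ (n - d) / (q - 1) ^ n = qnum q (real j) ^ (n - d)" for j
      using assms by (simp add: qnum_of_nat power_divide)
    then show ?thesis by (simp add: sum_distrib_left)
  qed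
  also have "{..<N} = {0..N - 1}" using assms by auto
  finally show ?thesis using F by (simp add: e_def)
qed

end
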